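(* Let $(L,[\cdot,\cdot,\cdot])$ be a Lie triple system, $(M,\theta)$ a representation of it, $\mathcal H$ a 3-cocycle of $L$ with coefficients in $(M,\theta)$, and $T:M\to L$ a generalized Reynolds operator. Then $$\{u,v,w\}=\theta(Tv,Tw)u\qquad\text{and}\qquad [u,v,w]=\mathcal H(Tu,Tv,Tw)\qquad(u,v,w\in M)$$ define an NS-Lie triple system structure on $M$.
   Context: All vector spaces are over a field $\mathbb K$ of characteristic $0$. A Lie triple system (L.t.s.) is a vector space $L$ with a trilinear bracket satisfying $[x,x,y]=0$, $[x,y,z]+[y,z,x]+[z,x,y]=0$ and $[x,y,[z,t,e]]=[[x,y,z],t,e]+[z,[x,y,t],e]+[z,t,[x,y,e]]$ for all elements. A representation of an L.t.s. $L$ on a vector space $M$ is a bilinear map $\theta:L\times L\to \mathrm{End}(M)$ such that, with $D(x,y):=\theta(y,x)-\theta(x,y)$, $\theta(z,t)\theta(x,y)-\theta(y,t)\theta(x,z)-\theta(x,[y,z,t])+D(y,z)\theta(x,t)=0$ and $\theta(z,t)D(x,y)-D(x,y)\theta(z,t)+\theta([x,y,z],t)+\theta(z,[x,y,t])=0$. A 3-cocycle is a trilinear map $\mathcal H:L\times L\times L\to M$ with $\mathcal H(x,x,y)=0$, $\mathcal H(x,y,z)+\mathcal H(y,z,x)+\mathcal H(z,x,y)=0$ and $\mathcal H(x_1,x_2,[y_1,y_2,y_3])+D(x_1,x_2)\mathcal H(y_1,y_2,y_3)-\mathcal H([x_1,x_2,y_1],y_2,y_3)-\mathcal H(y_1,[x_1,x_2,y_2],y_3)=\mathcal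 H(y_1,y_2,[x_1,x_2,y_3])+\theta(y_2,y_3)\mathcal H(x_1,x_2,y_1)-\theta(y_1,y_3)\mathcal H(x_1,x_2,y_2)+D(y_1,y_2)\mathcal H(x_1,x_2,y_3)$. A linear map $T:M\to L$ is a generalized Reynolds operator if for all $u,v,w\in M$ $[Tu,Tv,Tw]=T\big(D(Tu,Tv)w+\theta(Tv,Tw)u-\theta(Tu,Tw)v+\mathcal H(Tu,Tv,Tw)\big)$. An NS-Lie triple system is a vector space $A$ with two trilinear maps $\{\cdot,\cdot,\cdot\},[\cdot,\cdot,\cdot]:A^3\to A$ such that, writing $\{y_1,y_2,y_3\}^\ast=\{y_3,y_2,y_1\}-\{y_3,y_1,y_2\}$ and $[\![y_1,y_2,y_3]\!]=\{y_1,y_2,y_3\}^\ast+\{y_1,y_2,y_3\}-\{y_2,y_1,y_3\}+[y_1,y_2,y_3]$, for all $x_1,x_2,y_1,y_2,y_3\in A$: (1) $[y_1,y_2,y_3]=-[y_2,y_1,y_3]$ and $[y_1,y_2,y_3]+[y_2,y_3,y_1]+[y_3,y_1,y_2]=0$; (2) $\{x_1,x_2,[\![y_1,y_2,y_3]\!]\}=\{\{x_1,x_2,y_1\},y_2,y_3\}-\{\{x_1,x_2,y_2\},y_1,y_3\}+\{y_1,y_2,\{x_1,x_2,y_3\}\}^\ast$; (3) $\{x_1,x_2,\{y_1,y_2,y_3\}\}^\ast=\{\{x_1,x_2,y_1\}^\ast,y_2,y_3\}+\{y_1,[\![x_1,x_2,y_2]\!],y_3\}+\{y_1,y_2,[\![x_1,x_2,y_3]\!]\}$;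 (4) $[x_1,x_2,[\![y_1,y_2,y_3]\!]]=[[\![x_1,x_2,y_1]\!],y_2,y_3]+[y_1,[\![x_1,x_2,y_2]\!],y_3]+[y_1,y_2,[\![x_1,x_2,y_3]\!]]+\{[x_1,x_2,y_1],y_2,y_3\}-\{[x_1,x_2,y_2],y_1,y_3\}+\{y_1,y_2,[x_1,x_2,y_3]\}^\ast-\{x_1,x_2,[y_1,y_2,y_3]\}^\ast$. *)

theory Defs imports Complex_Main begin

definition trilinear ::
    "('k::field \<Rightarrow> 'a::ab_group_add \<Rightarrow> 'a) \<Rightarrow> ('k \<Rightarrow> 'b::ab_group_add \<Rightarrow> 'b) \<Rightarrow>
     ('k \<Rightarrow> 'c::ab_group_add \<Rightarrow> 'c) \<Rightarrow> ('k \<Rightarrow> 'd::ab_group_add \<Rightarrow> 'd) \<Rightarrow>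
     ('a \<Rightarrow> 'b \<Rightarrow> 'c \<Rightarrow> 'd) \<Rightarrow> bool"
  where "trilinear s1 s2 s3 s4 f \<longleftrightarrow>
    (\<forall>y z. Vector_Spaces.linear s1 s4 (\<lambda>x. f x y z)) \<and>
    (\<forall>x z. Vector_Spaces.linear s2 s4 (\<lambda>y. f x y z)) \<and>
    (\<forall>x y. Vector_Spaces.linear s3 s4 (\<lambda>z. f x y z))"

locale lie_triple_system = vector_space scale
  for scale :: "'k::field_char_0 \<Rightarrow> 'l::ab_group_add \<Rightarrow> 'l"
  and br :: "'l \<Rightarrow> 'l \<Rightarrow> 'l \<Rightarrow> 'l" +
  assumes br_trilinear: "trilinear scale scale scale scale br"
    and br_alternating: "br x x y = 0"
    and br_cyclic: "br x y z + br y z x + br z x y = 0"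
    and br_derivation:
      "br x y (br z t e) = br (br x y z) t e + br z (br x y t) e + br z t (br x y e)"

text \<open>The operator \<open>D(x,y) = \<theta>(y,x) - \<theta>(x,y)\<close> on the representation space.\<close>

definition rep_D :: "('l \<Rightarrow> 'l \<Rightarrow> 'm \<Rightarrow> 'm::ab_group_add) \<Rightarrow> 'l \<Rightarrow> 'l \<Rightarrow> 'm \<Rightarrow> 'm"
  where "rep_D \<theta> x y v = \<theta> y x v - \<theta> x y v"

text \<open>
  The vector space structure of \<open>End(M)\<close> is the pointwise one, so a bilinear map
  \<open>\<theta> : L \<times> L \<rightarrow> End(M)\<close> is a curried map whose values are linear and which is
  linear in each of its two arguments when evaluated at any vector of \<open>M\<close>; identities in
  \<open>End(M)\<close> are likewise stated at an arbitrary vector \<open>v\<close>.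
\<close>

locale lts_representation =
  L: lie_triple_system scaleL br + M: vector_space scaleM
  for scaleL :: "'k::field_char_0 \<Rightarrow> 'l::ab_group_add \<Rightarrow> 'l"
  and br :: "'l \<Rightarrow> 'l \<Rightarrow> 'l \<Rightarrow> 'l"
  and scaleM :: "'k \<Rightarrow> 'm::ab_group_add \<Rightarrow> 'm"
  and \<theta> :: "'l \<Rightarrow> 'l \<Rightarrow> 'm \<Rightarrow> 'm" +
  assumes rep_endo: "Vector_Spaces.linear scaleM scaleM (\<theta> x y)"
    and rep_linear_left: "Vector_Spaces.linear scaleL scaleM (\<lambda>x. \<theta> x y v)"
    and rep_linear_right: "Vector_Spaces.linear scaleL scaleM (\<lambda>y. \<theta> x y v)"
    and rep_theta:
      "\<theta> z t (\<theta> x y v) - \<theta> y t (\<theta> x z v) - \<theta> x (br y z t) v + rep_D \<theta> y z (\<theta> x t v) = 0"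
    and rep_comm:
      "\<theta> z t (rep_D \<theta> x y v) - rep_D \<theta> x y (\<theta> z t v) + \<theta> (br x y z) t v + \<theta> z (br x y t) v = 0"

locale lts_3_cocycle = lts_representation scaleL br scaleM \<theta>
  for scaleL :: "'k::field_char_0 \<Rightarrow> 'l::ab_group_add \<Rightarrow> 'l"
  and br :: "'l \<Rightarrow> 'l \<Rightarrow> 'l \<Rightarrow> 'l"
  and scaleM :: "'k \<Rightarrow> 'm::ab_group_add \<Rightarrow> 'm"
  and \<theta> :: "'l \<Rightarrow> 'l \<Rightarrow> 'm \<Rightarrow> 'm"
  and H :: "'l \<Rightarrow> 'l \<Rightarrow> 'l \<Rightarrow> 'm" +
  assumes H_trilinear: "trilinear scaleL scaleL scaleL scaleM H"
    and H_alternating: "H x x y = 0"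
    and H_cyclic: "H x y z + H y z x + H z x y = 0"
    and H_cocycle:
      "H x1 x2 (br y1 y2 y3) + rep_D \<theta> x1 x2 (H y1 y2 y3)
         - H (br x1 x2 y1) y2 y3 - H y1 (br x1 x2 y2) y3
       = H y1 y2 (br x1 x2 y3) + \<theta> y2 y3 (H x1 x2 y1)
         - \<theta> y1 y3 (H x1 x2 y2) + rep_D \<theta> y1 y2 (H x1 x2 y3)"

locale generalized_reynolds_operator = lts_3_cocycle scaleL br scaleM \<theta> H
  for scaleL :: "'k::field_char_0 \<Rightarrow> 'l::ab_group_add \<Rightarrow> 'l"
  and br :: "'l \<Rightarrow> 'l \<Rightarrow> 'l \<Rightarrow> 'l"
  and scaleM :: "'k \<Rightarrow> 'm::ab_group_add \<Rightarrow> 'm"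
  and \<theta> :: "'l \<Rightarrow> 'l \<Rightarrow> 'm \<Rightarrow> 'm"
  and H :: "'l \<Rightarrow> 'l \<Rightarrow> 'l \<Rightarrow> 'm"
  and T :: "'m \<Rightarrow> 'l" +
  assumes T_linear: "Vector_Spaces.linear scaleM scaleL T"
    and T_reynolds:
      "br (T u) (T v) (T w) =
       T (rep_D \<theta> (T u) (T v) w + \<theta> (T v) (T w) u - \<theta> (T u) (T w) v + H (T u) (T v) (T w))"

text \<open>
  For an NS-Lie triple system, \<open>cu\<close> is the curly operation \<open>{_,_,_}\<close> and \<open>sq\<close> the square
  operation \<open>[_,_,_]\<close>; \<open>ns_star cu\<close> is \<open>{_,_,_}\<^sup>*\<close> and \<open>ns_total cu sq\<close> is the double
  bracket built from both.
\<close>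

definition ns_star :: "('a \<Rightarrow> 'a \<Rightarrow> 'a \<Rightarrow> 'a::ab_group_add) \<Rightarrow> 'a \<Rightarrow> 'a \<Rightarrow> 'a \<Rightarrow> 'a"
  where "ns_star cu y1 y2 y3 = cu y3 y2 y1 - cu y3 y1 y2"

definition ns_total ::
    "('a \<Rightarrow> 'a \<Rightarrow> 'a \<Rightarrow> 'a::ab_group_add) \<Rightarrow> ('a \<Rightarrow> 'a \<Rightarrow> 'a \<Rightarrow> 'a) \<Rightarrow> 'a \<Rightarrow> 'a \<Rightarrow> 'a \<Rightarrow> 'a"
  where "ns_total cu sq y1 y2 y3 = ns_star cu y1 y2 y3 + cu y1 y2 y3 - cu y2 y1 y3 + sq y1 y2 y3"

locale ns_lie_triple_system = vector_space scale
  for scale :: "'k::field_char_0 \<Rightarrow> 'a::ab_group_add \<Rightarrow> 'a"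
  and cu :: "'a \<Rightarrow> 'a \<Rightarrow> 'a \<Rightarrow> 'a"
  and sq :: "'a \<Rightarrow> 'a \<Rightarrow> 'a \<Rightarrow> 'a" +
  assumes cu_trilinear: "trilinear scale scale scale scale cu"
    and sq_trilinear: "trilinear scale scale scale scale sq"
    and sq_skew: "sq y1 y2 y3 = - sq y2 y1 y3"
    and sq_cyclic: "sq y1 y2 y3 + sq y2 y3 y1 + sq y3 y1 y2 = 0"
    and cu_total:
      "cu x1 x2 (ns_total cu sq y1 y2 y3) =
         cu (cu x1 x2 y1) y2 y3 - cu (cu x1 x2 y2) y1 y3 + ns_star cu y1 y2 (cu x1 x2 y3)"
    and star_cu:
      "ns_star cu x1 x2 (cu y1 y2 y3) =
         cu (ns_star cu x1 x2 y1) y2 y3 + cu y1 (ns_total cu sq x1 x2 y2) y3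
         + cu y1 y2 (ns_total cu sq x1 x2 y3)"
    and sq_total:
      "sq x1 x2 (ns_total cu sq y1 y2 y3) =
         sq (ns_total cu sq x1 x2 y1) y2 y3 + sq y1 (ns_total cu sq x1 x2 y2) y3
         + sq y1 y2 (ns_total cu sq x1 x2 y3)
         + cu (sq x1 x2 y1) y2 y3 - cu (sq x1 x2 y2) y1 y3
         + ns_star cu y1 y2 (sq x1 x2 y3) - ns_star cu x1 x2 (sq y1 y2 y3)"

end

theory Submission imports Defs begin

text \<open>
  With \<open>{u,v,w} = \<theta>(Tv,Tw)u\<close>, the derived operation \<open>{u,v,w}\<^sup>*\<close> is \<open>D(Tu,Tv)w\<close>, so the double
  bracket is exactly the argument of \<open>T\<close> in the Reynolds identity. Hence \<open>T\<close> carries the double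
  bracket of \<open>M\<close> to the bracket of \<open>L\<close> (\<open>T_induced_total\<close>). In each axiom of an NS-Lie triple
  system a double bracket only ever occurs inside \<open>T\<close>, where it can thus be replaced by the
  bracket of \<open>L\<close>. The axioms then become identities of \<open>L\<close> and \<open>M\<close> evaluated at elements of
  the form \<open>Tu\<close>: \<open>cu_total\<close> is the representation identity \<open>rep_theta\<close>, \<open>star_cu\<close> is
  \<open>rep_comm\<close>, and \<open>sq_total\<close> is the cocycle condition. Skewness, which the cocycle is only
  assumed to satisfy in its alternating form, follows by polarization.
\<close>

lemma trilinear_comp:
  assumes "trilinear s s s s' f" and T: "Vector_Spaces.linear t s T"
  shows "trilinear t t t s' (\<lambda>u v w. f (T u) (T v) (T w))"
  using assms(1) Vector_Spaces.linear_compose[OF T, unfolded o_def]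
  unfolding trilinear_def by blast

text \<open>
  Polarization: \<open>0 = f(x+y,x+y,z) = f(x,y,z) + f(y,x,z)\<close>.
\<close>

lemma trilinear_alternating_imp_skew:
  assumes tri: "trilinear s s s s' f" and alt: "\<And>x z. f x x z = 0"
  shows "f x y z = - f y x z"
proof -
  have l: "f (a + b) c z = f a c z + f b c z" for a b c
    using tri
    unfolding trilinear_def linear_iff_module_hom by (metis (no_types, lifting) module_hom.add)
  have r: "f a (b + c) z = f a b z + f a c z" for a b c
    using tri
    unfolding trilinear_def linear_iff_module_hom by (metis (no_types, lifting) module_hom.add)
  have "0 = f (x + y) (x + y) z"
    by (simp add: alt)
  also have "\<dots> = f x y z + f y x z"
    unfolding l r by (simp add: alt)
  finally show ?thesis
    by (metis eq_neg_iff_add_eq_0)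
qed

context generalized_reynolds_operator
begin

definition induced_cu :: "'m \<Rightarrow> 'm \<Rightarrow> 'm \<Rightarrow> 'm"
  where "induced_cu u v w = \<theta> (T v) (T w) u"

definition induced_sq :: "'m \<Rightarrow> 'm \<Rightarrow> 'm \<Rightarrow> 'm"
  where "induced_sq u v w = H (T u) (T v) (T w)"

lemma star_induced_cu: "ns_star induced_cu u v w = rep_D \<theta> (T u) (T v) w"
  by (simp add: ns_star_def induced_cu_def rep_D_def)

lemma T_induced_total: "T (ns_total induced_cu induced_sq u v w) = br (T u) (T v) (T w)"
  unfolding ns_total_def star_induced_cu T_reynolds by (simp add: induced_cu_def induced_sq_def)

lemma induced_cu_trilinear: "trilinear scaleM scaleM scaleM scaleM induced_cu"
  unfolding trilinear_def induced_cu_def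
  using rep_endo Vector_Spaces.linear_compose[OF T_linear rep_linear_left, unfolded o_def]
    Vector_Spaces.linear_compose[OF T_linear rep_linear_right, unfolded o_def]
  by blast

theorem induced_ns_lie_triple_system: "ns_lie_triple_system scaleM induced_cu induced_sq"
proof
  show "trilinear scaleM scaleM scaleM scaleM induced_cu"
    by (rule induced_cu_trilinear)
  show "trilinear scaleM scaleM scaleM scaleM induced_sq"
    unfolding induced_sq_def by (rule trilinear_comp[OF H_trilinear T_linear])
  fix x1 x2 y1 y2 y3
  show "induced_sq y1 y2 y3 = - induced_sq y2 y1 y3"
    unfolding induced_sq_def by (rule trilinear_alternating_imp_skew[OF H_trilinear H_alternating])
  show "induced_sq y1 y2 y3 + induced_sq y2 y3 y1 + induced_sq y3 y1 y2 = 0"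
    unfolding induced_sq_def by (rule H_cyclic)
  show "induced_cu x1 x2 (ns_total induced_cu induced_sq y1 y2 y3) =
      induced_cu (induced_cu x1 x2 y1) y2 y3 - induced_cu (induced_cu x1 x2 y2) y1 y3
      + ns_star induced_cu y1 y2 (induced_cu x1 x2 y3)"
    using rep_theta[of "T y2" "T y3" "T x2" "T y1" x1]
    unfolding star_induced_cu by (simp add: induced_cu_def T_induced_total algebra_simps)
  show "ns_star induced_cu x1 x2 (induced_cu y1 y2 y3) =
      induced_cu (ns_star induced_cu x1 x2 y1) y2 y3
      + induced_cu y1 (ns_total induced_cu induced_sq x1 x2 y2) y3
      + induced_cu y1 y2 (ns_total induced_cu induced_sq x1 x2 y3)"
    using rep_comm[of "T y2" "T y3" "T x1" "T x2" y1]
    unfolding star_induced_cu by (simp add: induced_cu_def T_induced_total algebra_simps)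
  show "induced_sq x1 x2 (ns_total induced_cu induced_sq y1 y2 y3) =
      induced_sq (ns_total induced_cu induced_sq x1 x2 y1) y2 y3
      + induced_sq y1 (ns_total induced_cu induced_sq x1 x2 y2) y3
      + induced_sq y1 y2 (ns_total induced_cu induced_sq x1 x2 y3)
      + induced_cu (induced_sq x1 x2 y1) y2 y3 - induced_cu (induced_sq x1 x2 y2) y1 y3
      + ns_star induced_cu y1 y2 (induced_sq x1 x2 y3)
      - ns_star induced_cu x1 x2 (induced_sq y1 y2 y3)"
    using H_cocycle[of "T x1" "T x2" "T y1" "T y2" "T y3"]
    unfolding star_induced_cu
    by (simp add: induced_cu_def induced_sq_def T_induced_total algebra_simps)
qed

end

theorem theorem6p2:
  fixes scaleL :: "'k::field_char_0 \<Rightarrow> 'l::ab_group_add \<Rightarrow> 'l"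
    and br :: "'l \<Rightarrow> 'l \<Rightarrow> 'l \<Rightarrow> 'l"
    and scaleM :: "'k \<Rightarrow> 'm::ab_group_add \<Rightarrow> 'm"
    and \<theta> :: "'l \<Rightarrow> 'l \<Rightarrow> 'm \<Rightarrow> 'm"
    and H :: "'l \<Rightarrow> 'l \<Rightarrow> 'l \<Rightarrow> 'm"
    and T :: "'m \<Rightarrow> 'l"
  assumes "lie_triple_system scaleL br"
    and "lts_representation scaleL br scaleM \<theta>"
    and "lts_3_cocycle scaleL br scaleM \<theta> H"
    and "generalized_reynolds_operator scaleL br scaleM \<theta> H T"
  shows "ns_lie_triple_system scaleM
           (\<lambda>u v w. \<theta> (T v) (T w) u)
           (\<lambda>u v w. H (T u) (T v) (T w))"
proof -
  interpret generalized_reynolds_operator scaleL br scaleM \<theta> H T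
    by (rule assms(4))
  show ?thesis
    using induced_ns_lie_triple_system unfolding induced_cu_def[abs_def] induced_sq_def[abs_def] .
qed

end
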